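(* Let $n$ be a positive integer. Then the following statements hold. (i) $\mathrm{Out}(\tau,n)\subseteq\{u\in\mathbb{N} \mid u\geq \tau(n)\}$. (ii) $\mathrm{Out}(\tau,n)=\mathbb{N}$ if and only if $n=1$. (iii) $\mathrm{Out}(\tau,n)$ is a cofinite subset of $\mathbb{N}$ if and only if $n=p^k$ for some prime $p$ and nonnegative integer $k$. (iv) $\mathrm{Out}(\tau,n)$ is always an infinite set.
   Context: $\mathbb{N}$ denotes the set of positive integers. For $m\in\mathbb{N}$, $\tau(m)$ is the number of positive divisors of $m$. For an arithmetic function $g$ and $n\in\mathbb{N}$, $\mathrm{Out}(g,n)$ is the set of all $u\in\mathbb{N}$ for which there exists a positive integer $N$ such that $n\mid N$ and $g(N)=u$. A subset of $\mathbb{N}$ is cofinite if its complement in $\mathbb{N}$ is finite. *)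

theory Defs
  imports Complex_Main "HOL-Computational_Algebra.Primes"
begin

abbreviation pos_nats :: "nat set" where
  "pos_nats \<equiv> {0<..}"

text \<open>Only meaningful for positive arguments: every number divides 0, so \<open>\<tau> 0 = 0\<close> here.\<close>

definition tau :: "nat \<Rightarrow> nat" ("\<tau>") where
  "\<tau> m = card {d. d dvd m}"

text \<open>An arithmetic function is defined on the positive integers only; its value at 0 is
  irrelevant because \<open>N\<close> ranges over positive integers.\<close>

definition Out :: "(nat \<Rightarrow> nat) \<Rightarrow> nat \<Rightarrow> nat set" where
  "Out g n = {u \<in> pos_nats. \<exists>N\<in>pos_nats. n dvd N \<and> g N = u}"

definition cofinite_pos :: "nat set \<Rightarrow> bool" where
  "cofinite_pos A \<longleftrightarrow> A \<subseteq> pos_nats \<and> finite (pos_nats - A)"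

end

theory Submission
  imports Defs
begin

text \<open>Everything beyond monotonicity of \<open>\<tau>\<close> under divisibility rests on
  \<open>\<tau> (p ^ k) = k + 1\<close> and one observation: if \<open>\<tau> N\<close> is prime, then splitting off the
  full power of a prime dividing \<open>N\<close> factors \<open>\<tau> N\<close>, so \<open>N\<close>, and with it every divisor of \<open>N\<close>,
  is a prime power. A cofinite set contains a prime, hence \<open>Out \<tau> n\<close> is cofinite only when
  \<open>n\<close> is a prime power.\<close>

lemma finite_divisors: "m > 0 \<Longrightarrow> finite {d::nat. d dvd m}"
  by (rule finite_subset[of _ "{..m}"]) (auto dest: dvd_imp_le)

lemma tau_mono: "n dvd N \<Longrightarrow> N > 0 \<Longrightarrow> \<tau> n \<le> \<tau> N"
  unfolding tau_def by (rule card_mono) (auto intro: finite_divisors dvd_trans)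

text \<open>\<open>Out\<close> keeps only positive values, so a value of \<open>\<tau>\<close> has
  to be known to be positive before it can be placed there.\<close>

lemma tau_pos: "m > 0 \<Longrightarrow> \<tau> m > 0"
  unfolding tau_def using finite_divisors[of m] by (auto simp: card_gt_0_iff)

lemma tau_le_one_imp:
  assumes "m > 0" "\<tau> m \<le> 1"
  shows "m = 1"
proof -
  have "card {1, m} \<le> card {d. d dvd m}"
    using assms by (intro card_mono finite_divisors) auto
  with assms show ?thesis by (auto simp: tau_def card_insert_if split: if_splits)
qed

lemma tau_prime_power:
  assumes "prime (p::nat)"
  shows "\<tau> (p ^ k) = Suc k"
proof -
  have "{d. d dvd p ^ k} = (\<lambda>i. p ^ i) ` {..k}"
    using divides_primepow_nat[OF assms] by auto
  moreover have "inj_on (\<lambda>i. p ^ i) {..k}"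
    using prime_gt_1_nat[OF assms] by (auto intro!: inj_onI)
  ultimately show ?thesis by (simp add: tau_def card_image)
qed

text \<open>Pairs of divisors of \<open>a\<close> and \<open>b\<close> correspond to divisors of
  \<open>a * b\<close> by multiplication, with inverse
  \<open>d \<mapsto> (gcd d a, gcd d b)\<close>. If \<open>a\<close> or \<open>b\<close> is 0, both
  sides are 0, since infinite sets have \<open>card\<close> 0.\<close>

lemma tau_mult_coprime:
  assumes "coprime a b"
  shows "\<tau> (a * b) = \<tau> a * \<tau> b"
proof -
  \<comment> \<open>A divisor \<open>y\<close> of \<open>b\<close> is coprime to \<open>a\<close>,
    so it cancels from \<open>gcd (x * y) a\<close> and leaves \<open>gcd x a = x\<close>; likewise
    with the roles swapped.\<close>
  have gcds: "gcd (x * y) a = x" "gcd (x * y) b = y" if "x dvd a" "y dvd b" for x y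
  proof -
    have "coprime a y" "coprime b x"
      using coprime_divisors[OF dvd_refl that(2) assms] coprime_divisors[OF that(1) dvd_refl assms]
      by (simp_all only: coprime_commute[of x b])
    then have "gcd (x * y) a = gcd x a" "gcd (x * y) b = gcd y b"
      by (simp_all only: gcd_mult_left_right_cancel gcd_mult_left_left_cancel)
    with that show "gcd (x * y) a = x" "gcd (x * y) b = y"
      by (simp_all only: gcd_nat.absorb1)
  qed
  have "bij_betw (\<lambda>(x, y). x * y) ({d. d dvd a} \<times> {d. d dvd b}) {d. d dvd a * b}"
  proof (rule bij_betw_byWitness[where f' = "\<lambda>d. (gcd d a, gcd d b)"])
    show "\<forall>d\<in>{d. d dvd a * b}. (\<lambda>(x, y). x * y) (gcd d a, gcd d b) = d"
    proof
      fix d assume "d \<in> {d. d dvd a * b}"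
      then obtain x y where xy: "d = x * y" "x dvd a" "y dvd b"
        using division_decomp[of d a b] by blast
      then show "(\<lambda>(x, y). x * y) (gcd d a, gcd d b) = d"
        by (simp only: gcds[OF xy(2,3)] prod.case)
    qed
    show "\<forall>z\<in>{d. d dvd a} \<times> {d. d dvd b}.
        (\<lambda>d. (gcd d a, gcd d b)) ((\<lambda>(x, y). x * y) z) = z"
      by (simp add: gcds split_beta mem_Times_iff)
    show "(\<lambda>(x, y). x * y) ` ({d. d dvd a} \<times> {d. d dvd b}) \<subseteq> {d. d dvd a * b}"
      by (simp add: image_subset_iff mult_dvd_mono)
  qed (simp add: image_subset_iff)
  from bij_betw_same_card[OF this] show ?thesis
    by (simp add: tau_def card_cartesian_product)
qed

lemma prime_tau_imp_prime_power:
  assumes "N > 0" "prime (\<tau> N)"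
  shows "\<exists>p k. prime p \<and> N = p ^ k"
proof -
  have "N \<noteq> 1"
    using assms(2) by (auto simp: tau_def)
  then obtain p where p: "prime p" "p dvd N"
    using prime_factor_nat by blast
  obtain M a where M: "N = p ^ a * M" "\<not> p dvd M"
    using multiplicity_decompose'[of N p] assms(1) p(1) by (metis not_prime_unit gr_implies_not0)
  have "coprime (p ^ a) M"
    using p M(2) by (simp add: prime_imp_coprime)
  then have tau_N: "\<tau> N = Suc a * \<tau> M"
    by (simp only: M(1) tau_mult_coprime tau_prime_power[OF p(1)])
  have "a \<noteq> 0"
    using p(2) M by (cases a) auto
  \<comment> \<open>One factor of the prime \<open>Suc a * \<tau> M\<close> must be 1, and
    \<open>Suc a\<close> is at least 2.\<close>
  then have "\<tau> M = 1"
    using assms(2) prime_product[of "Suc a" "\<tau> M"] by (simp add: tau_N del: mult_Suc)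
  moreover have "M > 0"
    using M(2) by (cases M) auto
  ultimately have "M = 1"
    using tau_le_one_imp by simp
  then have "N = p ^ a" using M(1) by simp
  with p(1) show ?thesis by blast
qed

lemma Out_tau_le: "Out \<tau> n \<subseteq> {u \<in> pos_nats. u \<ge> \<tau> n}"
  by (auto simp: Out_def intro: tau_mono)

text \<open>The witness for \<open>u\<close> is \<open>p ^ (u - 1)\<close>: it has exactly
  \<open>u\<close> divisors, and \<open>u > k\<close> makes it a multiple of
  \<open>p ^ k\<close>.\<close>

lemma Out_tau_prime_power_superset:
  assumes "prime (p::nat)"
  shows "{k<..} \<subseteq> Out \<tau> (p ^ k)"
proof
  fix u assume "u \<in> {k<..}"
  then have "k \<le> u - 1" "Suc (u - 1) = u" "u > 0" by auto
  moreover have "\<tau> (p ^ (u - 1)) = Suc (u - 1)" "p ^ (u - 1) > 0"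
    using assms by (simp_all only: tau_prime_power prime_gt_0_nat zero_less_power)
  ultimately show "u \<in> Out \<tau> (p ^ k)"
    unfolding Out_def by (metis (mono_tags, lifting) greaterThan_iff le_imp_power_dvd mem_Collect_eq)
qed

lemma Out_tau_eq_pos_nats_iff:
  assumes "n > 0"
  shows "Out \<tau> n = pos_nats \<longleftrightarrow> n = 1"
proof
  assume "Out \<tau> n = pos_nats"
  then have "\<tau> n \<le> 1" using Out_tau_le[of n] by auto
  then show "n = 1" using assms tau_le_one_imp by blast
next
  assume "n = 1"
  then show "Out \<tau> n = pos_nats"
    \<comment> \<open>Read 1 as \<open>2 ^ 0\<close>; then all values above 0 are attained.\<close>
    using Out_tau_prime_power_superset[OF two_is_prime_nat, of 0] by (auto simp: Out_def)
qed

lemma cofinite_pos_Out_tau_iff: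
  "cofinite_pos (Out \<tau> n) \<longleftrightarrow> (\<exists>(p::nat) k. prime p \<and> n = p ^ k)"
proof
  assume "cofinite_pos (Out \<tau> n)"
  then have "finite (pos_nats - Out \<tau> n)" by (simp add: cofinite_pos_def)
  then have "\<not> {q::nat. prime q} \<subseteq> pos_nats - Out \<tau> n"
    using primes_infinite finite_subset by blast
  then obtain q where "prime q" "q \<in> Out \<tau> n"
    by (auto simp: prime_gt_0_nat)
  then obtain N where N: "N > 0" "n dvd N" "prime (\<tau> N)"
    by (auto simp: Out_def)
  then obtain p k where "prime p" "N = p ^ k"
    using prime_tau_imp_prime_power by blast
  then show "\<exists>p k. prime p \<and> n = p ^ k"
    using N(2) divides_primepow_nat by blast
next
  assume "\<exists>(p::nat) k. prime p \<and> n = p ^ k"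
  then obtain k where "{k<..} \<subseteq> Out \<tau> n"
    using Out_tau_prime_power_superset by blast
  \<comment> \<open>Every value above \<open>k\<close> is attained, so only the finitely many values
    up to \<open>k\<close> can be missing.\<close>
  then have "pos_nats - Out \<tau> n \<subseteq> {..k}" by (auto simp: not_le)
  then show "cofinite_pos (Out \<tau> n)"
    using finite_subset by (auto simp: cofinite_pos_def Out_def)
qed

text \<open>The values at the multiples \<open>n * 2 ^ m\<close> are unbounded, because the divisor
  \<open>2 ^ m\<close> alone contributes \<open>m + 1\<close> divisors.\<close>

lemma infinite_Out_tau:
  assumes "n > 0"
  shows "infinite (Out \<tau> n)"
proof
  assume "finite (Out \<tau> n)"
  then obtain m where m: "\<forall>u\<in>Out \<tau> n. u < m"
    using finite_nat_set_iff_bounded by blast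
  have "m < \<tau> (n * 2 ^ m)"
    using tau_mono[of "2 ^ m" "n * 2 ^ m"] assms by (simp add: tau_prime_power)
  moreover have "\<tau> (n * 2 ^ m) \<in> Out \<tau> n"
    using assms tau_pos[of "n * 2 ^ m"]
    by (auto simp: Out_def intro!: bexI[of _ "n * 2 ^ m"])
  ultimately show False using m by fastforce
qed

theorem theorem6:
  fixes n :: nat
  assumes "n > 0"
  shows "Out \<tau> n \<subseteq> {u \<in> pos_nats. u \<ge> \<tau> n}
    \<and> (Out \<tau> n = pos_nats \<longleftrightarrow> n = 1)
    \<and> (cofinite_pos (Out \<tau> n) \<longleftrightarrow> (\<exists>(p::nat) (k::nat). prime p \<and> n = p ^ k))
    \<and> infinite (Out \<tau> n)"
  by (intro conjI Out_tau_le Out_tau_eq_pos_nats_iff cofinite_pos_Out_tau_iff infinite_Out_tau assms)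

end
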